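(* For $\boldsymbol{n} = (n_1,n_2,n_3,n_4) \in \mathbb{Z}^4$ define $$A(\boldsymbol{n}) = \sum_{k \in \mathbb{Z}} \binom{n_1}{k}\binom{n_3}{k}\binom{n_1+n_2-k}{n_1}\binom{n_3+n_4-k}{n_3}$$ (this sum has only finitely many nonzero terms). Then for all primes $p \geq 5$, all integers $r \geq 1$ and all $\boldsymbol{n} \in \mathbb{Z}^4$, $$A(p^r \boldsymbol{n}) \equiv A(p^{r-1}\boldsymbol{n}) \pmod{p^{3r}}.$$
   Context: For all integers $n, k$, the binomial coefficient is defined by $\binom{n}{k} = \lim_{z \to 0} \frac{\Gamma(z+n+1)}{\Gamma(z+k+1)\Gamma(z+n-k+1)}$. This is a finite integer for all $n,k\in\mathbb{Z}$, agrees with the usual binomial coefficient for $n \ge 0$, satisfies $\binom{n}{k}=\binom{n}{n-k}$, and for integers is nonzero only if ($k\ge0$ and $n-k\ge0$) or ($n<0$ and $k\ge 0$) or ($n<0$ and $n-k\ge0$); e.g. $\binom{-3}{-5}=\binom{-3}{2}=6$. For nonnegative $\boldsymbol{n}$, $A(\boldsymbol{n})$ is the coefficient of $x_1^{n_1}x_2^{n_2}x_3^{n_3}x_4^{n_4}$ in $1/((1-x_1-x_2)(1-x_3-x_4)-x_1x_2x_3x_4)$. *)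

theory Defs
  imports Complex_Main "HOL-Computational_Algebra.Primes" "HOL-Number_Theory.Cong"
begin

text \<open>Binomial coefficient for all integers n, k (the Gamma-limit convention of the paper):
  for k >= 0 it is the generalized binomial n(n-1)...(n-k+1)/k! (computed in rat; it is an integer); for k < 0 it is given by
  the symmetry binom(n,k) = binom(n,n-k) when n-k >= 0, and is 0 otherwise.\<close>
definition ibinom :: "int \<Rightarrow> int \<Rightarrow> int" where
  "ibinom n k =
     (if k \<ge> 0 then floor ((of_int n :: rat) gchoose (nat k))
      else if n - k \<ge> 0 then floor ((of_int n :: rat) gchoose (nat (n - k)))
      else 0)"

definition A_term :: "int \<Rightarrow> int \<Rightarrow> int \<Rightarrow> int \<Rightarrow> int \<Rightarrow> int" where
  "A_term n1 n2 n3 n4 k =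
     ibinom n1 k * ibinom n3 k * ibinom (n1 + n2 - k) n1 * ibinom (n3 + n4 - k) n3"

text \<open>Sum over all k in Z; only finitely many terms are nonzero.\<close>
definition A :: "int \<Rightarrow> int \<Rightarrow> int \<Rightarrow> int \<Rightarrow> int" where
  "A n1 n2 n3 n4 = (\<Sum>k \<in> {k. A_term n1 n2 n3 n4 k \<noteq> 0}. A_term n1 n2 n3 n4 k)"

end

theory Submission
  imports Defs "HOL-Number_Theory.Residues"
begin

text \<open>
  Write \<open>T\<^sub>r k\<close> for the summand of \<open>A (p\<^sup>r n)\<close>. If \<open>p\<close> divides \<open>k\<close>, then \<open>T\<^sub>r k\<close> is congruent to
  \<open>T\<^sub>r\<^sub>-\<^sub>1 (k / p)\<close>: each of the four binomials changes by a factor congruent to 1 modulo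
  \<open>p\<close> to the power \<open>r + 2 s\<close>, where \<open>s\<close> is the minimum of \<open>r\<close> and the
  exponent of \<open>p\<close> in \<open>k\<close> (Jacobsthal), and the first two contribute another factor \<open>p\<close> to the power \<open>2 (r - s)\<close>.

  If \<open>p\<close> does not divide \<open>k\<close>, absorption gives \<open>k\<^sup>2 T\<^sub>r k = p\<^sup>2\<^sup>r n\<^sub>1 n\<^sub>3 C\<^sub>r (k - 1)\<close> with
  \<open>C\<^sub>r i \<equiv> C\<^sub>r\<^sub>-\<^sub>1 (i div p)\<close> modulo \<open>p\<^sup>r\<close>. Summing by parts over blocks of length \<open>p\<^sup>s\<close>, on which
  the inverse squares sum to 0 modulo \<open>p\<^sup>s\<close> because \<open>p \<ge> 5\<close>, shows that the sum of these
  \<open>C\<^sub>r (k - 1) / k\<^sup>2\<close> vanishes modulo \<open>p\<^sup>r\<close> (Beukers).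
\<close>

section \<open>Quotients congruent to 1\<close>

text \<open>Says that \<open>x / y\<close> is congruent to 1. Unlike the congruence \<open>x \<equiv> y\<close>, this survives
  cancellation of factors \<open>p\<close>, and it gains from a factor \<open>p\<close> of \<open>y\<close>.\<close>

definition unit_ratio :: "int \<Rightarrow> nat \<Rightarrow> int \<Rightarrow> int \<Rightarrow> bool" where
  "unit_ratio p e x y \<longleftrightarrow> (\<exists>u v. coprime u p \<and> [u = v] (mod p ^ e) \<and> x * u = y * v)"

lemma unit_ratio_refl: "unit_ratio p e x x"
  unfolding unit_ratio_def by (intro exI[of _ 1]) auto

lemma unit_ratio_mult:
  assumes "unit_ratio p e x y" "unit_ratio p e x' y'"
  shows "unit_ratio p e (x * x') (y * y')"
proof -
  obtain u v where "coprime u p" "[u = v] (mod p ^ e)" "x * u = y * v"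
    using assms(1) unfolding unit_ratio_def by blast
  moreover obtain u' v' where "coprime u' p" "[u' = v'] (mod p ^ e)" "x' * u' = y' * v'"
    using assms(2) unfolding unit_ratio_def by blast
  ultimately have "coprime (u * u') p" "[u * u' = v * v'] (mod p ^ e)"
    "x * x' * (u * u') = y * y' * (v * v')"
    by (auto simp: cong_mult) (metis mult.assoc mult.left_commute)
  thus ?thesis unfolding unit_ratio_def by blast
qed

lemma unit_ratio_cancel:
  assumes "unit_ratio p e (c * x) (c * y)" "c \<noteq> 0"
  shows "unit_ratio p e x y"
  using assms unfolding unit_ratio_def by (auto simp: mult.assoc)

text \<open>Carries an induction through a recurrence with congruent coefficients \<open>a\<close>
  and \<open>c\<close>: they are absorbed into the witnesses \<open>u\<close> and
  \<open>v\<close>.\<close>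

lemma unit_ratio_step:
  assumes "unit_ratio p e x y" "a * x' = c * x" "coprime a p" "[a = c] (mod p ^ e)"
  shows "unit_ratio p e x' y"
proof -
  obtain u v where uv: "coprime u p" "[u = v] (mod p ^ e)" "x * u = y * v"
    using assms(1) unfolding unit_ratio_def by blast
  have "x' * (u * a) = c * x * u" using assms(2) by (simp add: mult_ac)
  also have "\<dots> = y * (v * c)" using uv(3) by (simp add: mult_ac)
  finally have "x' * (u * a) = y * (v * c)" .
  moreover have "coprime (u * a) p" "[u * a = v * c] (mod p ^ e)"
    using uv assms by (auto simp: cong_mult)
  ultimately show ?thesis unfolding unit_ratio_def by blast
qed

text \<open>From \<open>x * u = y * v\<close> follows \<open>(x - y) * u = (v - u) * y\<close>,
  where \<open>p ^ e\<close> divides \<open>v - u\<close> and \<open>p ^ f\<close> divides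
  \<open>y\<close>; the unit \<open>u\<close> drops out.\<close>

lemma unit_ratio_imp_cong:
  assumes "unit_ratio p e x y" "p ^ f dvd y"
  shows "[x = y] (mod p ^ (e + f))"
proof -
  obtain u v where uv: "coprime u p" "[u = v] (mod p ^ e)" "x * u = y * v"
    using assms(1) unfolding unit_ratio_def by blast
  have "p ^ e dvd v - u" using uv(2) by (meson cong_iff_dvd_diff cong_sym)
  hence "p ^ e * p ^ f dvd (v - u) * y" using assms(2) by (rule mult_dvd_mono)
  also have "(v - u) * y = (x - y) * u" using uv(3) by (simp add: algebra_simps)
  finally have "p ^ (e + f) dvd (x - y) * u" by (simp add: power_add)
  moreover have "coprime (p ^ (e + f)) u" using uv(1) by (simp add: coprime_commute)
  ultimately show ?thesis by (simp add: coprime_dvd_mult_left_iff cong_iff_dvd_diff)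
qed

lemma unit_ratio_uminus: "unit_ratio p e x y \<Longrightarrow> unit_ratio p e (- x) (- y)"
  unfolding unit_ratio_def by auto

lemma unit_ratio_minus_one_power:
  assumes "unit_ratio p e x y" "even m \<longleftrightarrow> even n"
  shows "unit_ratio p e ((-1) ^ m * x) ((-1) ^ n * y)"
  using assms unit_ratio_uminus[OF assms(1)] by (cases "even m") auto

section \<open>Power sums\<close>

lemma bij_betw_mod_block:
  fixes a m :: int
  assumes "m > 0"
  shows "bij_betw (\<lambda>i. i mod m) {a..<a + m} {0..<m}"
proof -
  have inj: "inj_on (\<lambda>i. i mod m) {a..<a + m}"
  proof (rule inj_onI)
    fix x y assume *: "x \<in> {a..<a + m}" "y \<in> {a..<a + m}" "x mod m = y mod m"
    hence "m dvd x - y" by (simp add: mod_eq_dvd_iff)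
    moreover have "\<bar>x - y\<bar> < m" using * by auto
    ultimately show "x = y" using dvd_imp_le_int[of "x - y" m] assms by (cases "x = y") auto
  qed
  have "(\<lambda>i. i mod m) ` {a..<a + m} = {0..<m}"
    by (rule card_subset_eq) (use assms in \<open>auto simp: card_image[OF inj]\<close>)
  thus ?thesis using inj by (simp add: bij_betw_def)
qed

lemma sum_power_block_cong:
  fixes a m :: int
  assumes "m > 0"
  shows "[(\<Sum>i\<in>{a..<a + m}. i ^ e) = (\<Sum>i\<in>{0..<m}. i ^ e)] (mod m)"
proof -
  have "(\<Sum>i\<in>{0..<m}. i ^ e) = (\<Sum>i\<in>{a..<a + m}. (i mod m) ^ e)"
    by (rule sum.reindex_bij_betw[OF bij_betw_mod_block[OF assms], symmetric])
  moreover have "[(\<Sum>i\<in>{a..<a + m}. i ^ e) = (\<Sum>i\<in>{a..<a + m}. (i mod m) ^ e)] (mod m)"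
    by (intro cong_sum cong_pow) (simp add: cong_def)
  ultimately show ?thesis by simp
qed

lemma bij_betw_double_mod:
  fixes m :: int
  assumes "m > 0" "odd m"
  shows "bij_betw (\<lambda>i. (2 * i) mod m) {0..<m} {0..<m}"
proof -
  have inj: "inj_on (\<lambda>i. (2 * i) mod m) {0..<m}"
  proof (rule inj_onI)
    fix x y assume *: "x \<in> {0..<m}" "y \<in> {0..<m}" "(2 * x) mod m = (2 * y) mod m"
    hence "m dvd 2 * (x - y)" by (simp add: mod_eq_dvd_iff right_diff_distrib)
    moreover have "coprime m 2" using assms by simp
    ultimately have "m dvd x - y" using coprime_dvd_mult_right_iff by blast
    moreover have "\<bar>x - y\<bar> < m" using * by auto
    ultimately show "x = y" using dvd_imp_le_int[of "x - y" m] assms by (cases "x = y") auto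
  qed
  have "(\<lambda>i. (2 * i) mod m) ` {0..<m} = {0..<m}"
    by (rule card_subset_eq) (use assms in \<open>auto simp: card_image[OF inj]\<close>)
  thus ?thesis using inj by (simp add: bij_betw_def)
qed

text \<open>Multiplication by 2 permutes the residues, so that the sum \<open>S\<close> satisfies \<open>4 S \<equiv> S\<close>.\<close>

lemma sum_power_residues_cong_0:
  fixes m :: int
  assumes "m > 0" "odd m" "coprime 3 m" and e: "[2 ^ (e + 2) = 1] (mod m)"
  shows "m dvd (\<Sum>i\<in>{0..<m}. i ^ e)"
proof -
  let ?S = "\<Sum>i\<in>{0..<m}. i ^ e"
  have "?S = (\<Sum>i\<in>{0..<m}. ((2 * i) mod m) ^ e)"
    by (rule sum.reindex_bij_betw[OF bij_betw_double_mod[OF assms(1,2)], symmetric])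
  moreover have "[(\<Sum>i\<in>{0..<m}. ((2 * i) mod m) ^ e) = (\<Sum>i\<in>{0..<m}. (2 * i) ^ e)] (mod m)"
    by (intro cong_sum cong_pow) (simp add: cong_def)
  moreover have "(\<Sum>i\<in>{0..<m}. (2 * i) ^ e) = 2 ^ e * ?S"
    by (simp add: power_mult_distrib sum_distrib_left)
  ultimately have "[?S = 2 ^ e * ?S] (mod m)" by metis
  hence "[4 * ?S = 4 * (2 ^ e * ?S)] (mod m)" by (rule cong_scalar_left)
  also have "4 * (2 ^ e * ?S) = 2 ^ (e + 2) * ?S" by simp
  also have "[2 ^ (e + 2) * ?S = 1 * ?S] (mod m)" using e by (rule cong_scalar_right)
  finally have "m dvd 3 * ?S" by (simp add: cong_iff_dvd_diff algebra_simps)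
  thus ?thesis using assms(3) by (simp add: coprime_dvd_mult_right_iff coprime_commute)
qed

section \<open>Inverse squares modulo prime powers\<close>

text \<open>The exponent of the inverse square modulo \<open>p ^ r\<close>; this power also kills the multiples of \<open>p\<close>.\<close>

definition inv_sq_exp :: "nat \<Rightarrow> nat \<Rightarrow> nat" where
  "inv_sq_exp p r = 2 * totient (p ^ r) - 2"

lemma coprime_int_prime_iff:
  assumes "prime p"
  shows "coprime k (int p) \<longleftrightarrow> \<not> int p dvd k"
proof -
  have "prime (int p)" using assms by simp
  thus ?thesis
    by (metis coprime_commute coprime_absorb_left not_prime_unit prime_imp_coprime)
qed

lemma inv_sq_exp_unit:
  assumes "prime p" "\<not> int p dvd k"
  shows "[k ^ (inv_sq_exp p r + 2) = 1] (mod (int p ^ r))"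
proof -
  let ?t = "totient (p ^ r)"
  have cop: "coprime k (int p)" using assms by (simp add: coprime_int_prime_iff)
  have pos: "?t > 0" using prime_gt_0_nat[OF assms(1)] by (simp only: totient_gt_0_iff zero_less_power)
  define x where "x = nat (k mod int p ^ r)"
  have m: "int p ^ r > 0" using prime_gt_0_nat[OF assms(1)] by simp
  have x: "[int x = k] (mod (int p ^ r))" using m by (simp add: x_def cong_def)
  have "coprime (int x) (int p ^ r)"
    using cong_imp_coprime[OF cong_sym[OF x]] cop by simp
  hence "coprime x (p ^ r)" by (metis coprime_int_iff of_nat_power)
  hence "[x ^ ?t = 1] (mod (p ^ r))" by (rule euler_theorem)
  hence "[int (x ^ ?t) = int 1] (mod int (p ^ r))" by (simp only: cong_int_iff)
  hence "[int x ^ ?t = 1] (mod (int p ^ r))" by simp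
  hence "[k ^ ?t = 1] (mod (int p ^ r))" using cong_pow[OF x, of ?t] by (meson cong_sym cong_trans)
  hence "[(k ^ ?t) ^ 2 = 1 ^ 2] (mod (int p ^ r))" by (rule cong_pow)
  \<comment> \<open>Thanks to the factor 2 the subtraction in \<open>inv_sq_exp\<close> is not
    truncated, even for \<open>r = 0\<close>, where the totient is 1.\<close>
  moreover have "inv_sq_exp p r + 2 = ?t * 2" using pos unfolding inv_sq_exp_def by arith
  ultimately show ?thesis by (simp add: power_mult)
qed

text \<open>For \<open>r = Suc m\<close> the totient \<open>p ^ m * (p - 1)\<close> is at least
  \<open>4 * Suc m\<close>. The bound is what makes this power kill the multiples of
  \<open>p\<close>.\<close>

lemma inv_sq_exp_ge:
  assumes "prime p" "p \<ge> 5"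
  shows "inv_sq_exp p r \<ge> r"
proof (cases r)
  case (Suc m)
  have "m < p ^ m" using assms by (intro power_gt_expt) auto
  hence "Suc m * 4 \<le> p ^ m * (p - 1)" using assms by (intro mult_mono) auto
  hence "Suc m * 4 \<le> totient (p ^ r)" using assms Suc by (simp only: totient_prime_power_Suc)
  thus ?thesis unfolding inv_sq_exp_def Suc by arith
qed auto

lemma inv_sq_exp_multiple:
  assumes "prime p" "p \<ge> 5" "int p dvd k"
  shows "int p ^ r dvd k ^ inv_sq_exp p r"
  using assms inv_sq_exp_ge[OF assms(1,2)] by (meson dvd_power_le)

lemma prime_ge_5_coprime_3:
  assumes "prime p" "p \<ge> (5::nat)"
  shows "coprime 3 (int p)"
proof -
  have "coprime 3 p" using assms by (intro primes_coprime) auto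
  thus ?thesis by (metis coprime_int_iff of_nat_numeral)
qed

lemma prime_ge_5_odd:
  assumes "prime p" "p \<ge> (5::nat)"
  shows "odd p"
  using assms by (intro prime_odd_nat) auto

text \<open>The exponent stays at level \<open>r\<close> while the block has length
  \<open>p ^ s\<close>; it inverts squares modulo the smaller power too. The descent needs a single
  weight for all \<open>s\<close>.\<close>

lemma inv_sq_sum_block:
  assumes "prime p" "p \<ge> 5" "s \<le> r"
  shows "int p ^ s dvd (\<Sum>i\<in>{a..<a + int p ^ s}. i ^ inv_sq_exp p r)"
proof -
  have pos: "int p ^ s > 0" using assms by simp
  have "\<not> int p dvd 2" using assms by (auto dest: zdvd_imp_le)
  hence "[2 ^ (inv_sq_exp p r + 2) = 1] (mod (int p ^ r))" by (rule inv_sq_exp_unit[OF assms(1)])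
  hence "[2 ^ (inv_sq_exp p r + 2) = 1] (mod (int p ^ s))"
    by (rule cong_dvd_modulus) (simp add: le_imp_power_dvd assms)
  hence "int p ^ s dvd (\<Sum>i\<in>{0..<int p ^ s}. i ^ inv_sq_exp p r)"
    by (intro sum_power_residues_cong_0)
      (use pos prime_ge_5_odd[OF assms(1,2)] prime_ge_5_coprime_3[OF assms(1,2)] in auto)
  thus ?thesis using sum_power_block_cong[OF pos, of "inv_sq_exp p r" a] cong_dvd_iff by blast
qed

lemma inv_sq_sum_blocks:
  assumes "prime p" "p \<ge> 5" "s \<le> r"
  shows "int p ^ s dvd (\<Sum>i\<in>{a..<a + int p ^ s * int q}. i ^ inv_sq_exp p r)"
proof (induction q)
  case (Suc q)
  let ?m = "int p ^ s"
  let ?b = "a + ?m * int q"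
  have "a \<le> ?b" by simp
  moreover have "0 \<le> ?m" by simp
  ultimately have "{a..<?b + ?m} = {a..<?b} \<union> {?b..<?b + ?m}"
    by (intro ivl_disj_un_two(3)[symmetric]) simp_all
  moreover have "{a..<?b} \<inter> {?b..<?b + ?m} = {}" by auto
  ultimately have "?m dvd (\<Sum>i\<in>{a..<?b + ?m}. i ^ inv_sq_exp p r)"
    using Suc inv_sq_sum_block[OF assms, of ?b] by (simp add: sum.union_disjoint)
  moreover have "a + ?m * int (Suc q) = ?b + ?m" by (simp add: algebra_simps)
  ultimately show ?case by metis
qed auto

section \<open>Factorials without the multiples of \<open>p\<close>\<close>

definition units_upto :: "nat \<Rightarrow> nat \<Rightarrow> nat set" where
  "units_upto p n = {i \<in> {1..n}. \<not> p dvd i}"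

text \<open>For prime \<open>p\<close> this is, up to sign, the value of Morita's p-adic Gamma
  function at \<open>n + 1\<close>.\<close>

definition pfact :: "nat \<Rightarrow> nat \<Rightarrow> int" where
  "pfact p n = (\<Prod>i\<in>units_upto p n. int i)"

lemma finite_units_upto [simp]: "finite (units_upto p n)"
  by (simp add: units_upto_def)

lemma units_upto_Suc:
  "units_upto p (Suc n) = (if p dvd Suc n then units_upto p n else insert (Suc n) (units_upto p n))"
  by (auto simp: units_upto_def le_Suc_eq)

lemma pfact_0 [simp]: "pfact p 0 = 1"
  by (simp add: pfact_def units_upto_def)

lemma pfact_Suc: "pfact p (Suc n) = (if p dvd Suc n then pfact p n else int (Suc n) * pfact p n)"
proof -
  have "Suc n \<notin> units_upto p n" by (auto simp: units_upto_def)
  thus ?thesis by (simp add: pfact_def units_upto_Suc)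
qed

lemma pfact_coprime:
  assumes "prime p"
  shows "coprime (pfact p n) (int p)"
  unfolding pfact_def
  by (rule prod_coprime_left) (auto simp: coprime_int_prime_iff[OF assms] units_upto_def)

text \<open>The multiples of \<open>p\<close> up to \<open>n\<close> are \<open>p\<close> times the
  numbers up to \<open>n div p\<close>.\<close>

lemma fact_eq_pfact:
  assumes "p > 0"
  shows "fact n = int p ^ (n div p) * fact (n div p) * pfact p n"
proof (induction n)
  case (Suc n)
  show ?case
  proof (cases "p dvd Suc n")
    case True
    then obtain q where q: "Suc n = p * q" by blast
    have "Suc n div p = Suc (n div p)" using True by (simp add: div_Suc dvd_eq_mod_eq_0)
    moreover have "Suc n div p = q" using q assms by simp
    ultimately have d: "q = Suc (n div p)" by simp
    have "fact (Suc n) = int (Suc n) * fact n" by (simp only: fact_Suc of_nat_Suc)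
    also have "int (Suc n) = int p * int (Suc (n div p))" unfolding q d by (simp add: algebra_simps)
    finally show ?thesis
      using True Suc \<open>Suc n div p = q\<close> d by (simp add: pfact_Suc algebra_simps)
  next
    case False
    hence "Suc n div p = n div p" by (simp add: div_Suc dvd_eq_mod_eq_0)
    thus ?thesis using False Suc by (simp add: pfact_Suc algebra_simps)
  qed
qed auto

text \<open>In the factorials of \<open>p * x\<close>, \<open>p * y\<close> and
  \<open>p * (x + y)\<close> the powers of \<open>p\<close> cancel, so the two binomials differ by a
  quotient of products free of multiples of \<open>p\<close>.\<close>

lemma binomial_mult_pfact:
  assumes "p > 0"
  shows "int ((p * (x + y)) choose (p * x)) * (pfact p (p * x) * pfact p (p * y)) =
         int ((x + y) choose x) * pfact p (p * (x + y))"
proof -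
  have B: "fact a * fact b * int ((a + b) choose a) = fact (a + b)" for a b
    using binomial_fact_lemma[of a "a + b"]
    by (metis add_diff_cancel_left' le_add1 of_nat_fact of_nat_mult)
  have F: "fact (p * n) = int p ^ n * fact n * pfact p (p * n)" for n
    using fact_eq_pfact[OF assms, of "p * n"] assms by simp
  let ?c = "int p ^ (x + y) * fact x * fact y"
  have "?c * (int ((p * (x + y)) choose (p * x)) * (pfact p (p * x) * pfact p (p * y))) =
        fact (p * x) * fact (p * y) * int ((p * x + p * y) choose (p * x))"
    by (simp add: F power_add algebra_simps)
  also have "\<dots> = fact (p * (x + y))" by (simp only: B) (simp add: algebra_simps)
  also have "\<dots> = int p ^ (x + y) * (fact x * fact y * int ((x + y) choose x)) * pfact p (p * (x + y))"
    by (simp only: F B)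
  also have "\<dots> = ?c * (int ((x + y) choose x) * pfact p (p * (x + y)))" by (simp add: algebra_simps)
  finally show ?thesis using assms by simp
qed

lemma prod_one_plus_cong:
  fixes c :: int
  assumes "finite I"
  shows "[(\<Prod>i\<in>I. 1 + c * f i) = 1 + c * sum f I] (mod (c ^ 2))"
  using assms
proof (induction I)
  case (insert j I)
  have "[(1 + c * f j) * (\<Prod>i\<in>I. 1 + c * f i) = (1 + c * f j) * (1 + c * sum f I)] (mod (c ^ 2))"
    using insert.IH by (rule cong_scalar_left)
  also have "(1 + c * f j) * (1 + c * sum f I) = 1 + c * (f j + sum f I) + c ^ 2 * (f j * sum f I)"
    by (simp add: algebra_simps power2_eq_square)
  also have "[\<dots> = 1 + c * (f j + sum f I)] (mod (c ^ 2))" by (simp add: cong_iff_dvd_diff)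
  finally show ?case using insert by simp
qed auto

text \<open>Here \<open>e i\<close> inverts \<open>d i\<close>, so each factor is
  \<open>d i * (1 + c * e i)\<close> modulo \<open>M\<close>. In the expansion the linear term is
  \<open>c * sum e I\<close>, and all later terms contain \<open>c ^ 2\<close>.\<close>

lemma prod_add_cong:
  fixes c m M :: int
  assumes "finite I" "M dvd c * m" "M dvd c ^ 2"
    and inv: "\<And>i. i \<in> I \<Longrightarrow> [d i * e i = 1] (mod m)" and sum: "m dvd sum e I"
  shows "[(\<Prod>i\<in>I. c + d i) = prod d I] (mod M)"
proof -
  have "[c + d i = d i * (1 + c * e i)] (mod M)" if "i \<in> I" for i
  proof -
    have "m dvd d i * e i - 1" using inv[OF that] by (simp add: cong_iff_dvd_diff)
    hence "M dvd c * (d i * e i - 1)" using assms(2) by (meson dvd_trans dvd_refl mult_dvd_mono)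
    thus ?thesis by (subst cong_sym_eq) (simp add: cong_iff_dvd_diff algebra_simps)
  qed
  hence "[(\<Prod>i\<in>I. c + d i) = (\<Prod>i\<in>I. d i * (1 + c * e i))] (mod M)" by (rule cong_prod)
  also have "(\<Prod>i\<in>I. d i * (1 + c * e i)) = prod d I * (\<Prod>i\<in>I. 1 + c * e i)"
    by (rule prod.distrib)
  also have "[\<dots> = prod d I * (1 + c * sum e I)] (mod M)"
    using cong_dvd_modulus[OF prod_one_plus_cong[OF assms(1)] assms(3)] by (rule cong_scalar_left)
  also have "M dvd c * sum e I" using assms(2) sum by (meson dvd_trans dvd_refl mult_dvd_mono)
  hence "[prod d I * (1 + c * sum e I) = prod d I * (1 + 0)] (mod M)"
    by (intro cong_scalar_left cong_add) (auto simp: cong_0_iff)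
  finally show ?thesis by simp
qed

lemma pfact_add:
  assumes "p dvd a"
  shows "pfact p (a + b) = pfact p a * (\<Prod>i\<in>units_upto p b. int a + int i)"
proof (induction b)
  case (Suc b)
  have "p dvd Suc (a + b) \<longleftrightarrow> p dvd Suc b"
    using assms by (metis add_Suc_right dvd_add_right_iff)
  moreover have "Suc b \<notin> units_upto p b" by (auto simp: units_upto_def)
  ultimately show ?case using Suc by (auto simp: pfact_Suc units_upto_Suc algebra_simps)
qed (auto simp: units_upto_def)

lemma units_upto_reflect:
  assumes "p dvd b"
  shows "bij_betw (\<lambda>i. b - i) (units_upto p b) (units_upto p b)"
proof (rule bij_betwI[where g = "\<lambda>i. b - i"])
  have "b - i \<in> units_upto p b" if "i \<in> units_upto p b" for i
  proof -
    from that have i: "1 \<le> i" "i \<le> b" "\<not> p dvd i" by (auto simp: units_upto_def)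
    moreover have "\<not> p dvd b - i" using i assms by (metis diff_diff_cancel dvd_diff_nat)
    moreover have "i \<noteq> b" using i assms by auto
    ultimately show ?thesis by (auto simp: units_upto_def)
  qed
  thus "(\<lambda>i. b - i) \<in> units_upto p b \<rightarrow> units_upto p b" by auto
  thus "(\<lambda>i. b - i) \<in> units_upto p b \<rightarrow> units_upto p b" .
qed (auto simp: units_upto_def)

text \<open>The sum over all of \<open>{1..b}\<close> consists of full blocks, and the multiples of
  \<open>p\<close> in it contribute 0 modulo \<open>p ^ s\<close>.\<close>

lemma inv_sq_sum_units:
  assumes "prime p" "p \<ge> 5" "p ^ s dvd b"
  shows "int p ^ s dvd (\<Sum>i\<in>units_upto p b. int i ^ inv_sq_exp p s)"
proof -
  obtain q where q: "b = p ^ s * q" using assms(3) by blast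
  let ?e = "inv_sq_exp p s"
  let ?D = "{i \<in> {1..b}. p dvd i}"
  have "int p ^ s dvd (\<Sum>i\<in>{1..<1 + int b}. i ^ ?e)"
    using inv_sq_sum_blocks[OF assms(1,2) order_refl, of s 1 q] by (simp add: q)
  moreover have "{1..<1 + int b} = int ` {1..b}"
    by (auto simp: image_int_atLeastAtMost)
  ultimately have "int p ^ s dvd (\<Sum>i\<in>{1..b}. int i ^ ?e)" by (simp add: sum.reindex)
  moreover have "(\<Sum>i\<in>{1..b}. int i ^ ?e) = (\<Sum>i\<in>units_upto p b. int i ^ ?e) + (\<Sum>i\<in>?D. int i ^ ?e)"
    unfolding units_upto_def by (subst sum.union_disjoint[symmetric]) (auto intro!: sum.cong)
  moreover have "int p ^ s dvd (\<Sum>i\<in>?D. int i ^ ?e)"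
    by (intro dvd_sum inv_sq_exp_multiple assms) auto
  ultimately show ?thesis by (simp add: dvd_add_left_iff)
qed

text \<open>The congruence modulo \<open>p\<close> selects the sign of the root:
  \<open>x + y\<close> is then congruent to the unit \<open>2 * y\<close> and can be divided out of
  \<open>(x - y) * (x + y)\<close>.\<close>

lemma cong_of_cong_squares:
  fixes x y :: int
  assumes "prime p" "p \<ge> 5" "[x ^ 2 = y ^ 2] (mod (int p ^ e))" "[x = y] (mod (int p))"
    and "coprime y (int p)"
  shows "[x = y] (mod (int p ^ e))"
proof -
  have "\<not> int p dvd 2" using assms by (auto dest: zdvd_imp_le)
  hence "coprime (2 * y) (int p)"
    using assms(5) coprime_int_prime_iff[OF assms(1), of 2] by (simp only: coprime_mult_left_iff) blast
  moreover have "[x + y = 2 * y] (mod (int p))"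
    using cong_add[OF assms(4) cong_refl[of y]] by simp
  ultimately have "coprime (x + y) (int p)" using cong_imp_coprime cong_sym by blast
  hence "coprime (int p ^ e) (x + y)" by (simp add: coprime_commute)
  moreover have "int p ^ e dvd (x - y) * (x + y)"
    using assms(3) by (simp add: cong_iff_dvd_diff algebra_simps power2_eq_square)
  ultimately show ?thesis by (simp add: coprime_dvd_mult_left_iff cong_iff_dvd_diff)
qed

text \<open>Pairing the factors \<open>a + i\<close> and \<open>a + (b - i)\<close> of the square of the left-hand side gives
  \<open>a (a + b) + i (b - i)\<close>, and the inverses of \<open>i (b - i) \<equiv> - i\<^sup>2\<close> sum to 0.\<close>

lemma prod_units_shift_cong:
  assumes p: "prime p" "p \<ge> 5" and s: "1 \<le> s" "s \<le> r" and "p ^ s dvd a" "p ^ s dvd b"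
    and c: "p ^ (r + s) dvd a * (a + b)"
  shows "[(\<Prod>i\<in>units_upto p b. int a + int i) = pfact p b] (mod (int p ^ (r + 2 * s)))"
proof (rule cong_of_cong_squares[OF p])
  let ?U = "units_upto p b" and ?c = "int a * (int a + int b)"
  let ?d = "\<lambda>i. int i * (int b - int i)" and ?e = "\<lambda>i. - (int i ^ inv_sq_exp p s)"
  have pb: "p dvd b" and pa: "p dvd a" using assms by (meson dvd_power dvd_trans less_le_trans zero_less_one)+
  \<comment> \<open>Stated for every shift \<open>k\<close>: \<open>k = a\<close> gives the
    left-hand side, and \<open>k = 0\<close> gives the square of \<open>pfact p b\<close>.\<close>
  have sq: "(\<Prod>i\<in>?U. int k + int i) ^ 2 = (\<Prod>i\<in>?U. int k * (int k + int b) + ?d i)" for k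
  proof -
    have "(\<Prod>i\<in>?U. int k + int i) = (\<Prod>i\<in>?U. int k + int (b - i))"
      by (rule prod.reindex_bij_betw[OF units_upto_reflect[OF pb], symmetric])
    hence "(\<Prod>i\<in>?U. int k + int i) ^ 2 = (\<Prod>i\<in>?U. (int k + int i) * (int k + int (b - i)))"
      by (simp add: power2_eq_square prod.distrib)
    also have "\<dots> = (\<Prod>i\<in>?U. int k * (int k + int b) + ?d i)"
      by (intro prod.cong) (auto simp: units_upto_def of_nat_diff algebra_simps)
    finally show ?thesis .
  qed
  have c': "int p ^ (r + s) dvd ?c" using c by (metis of_nat_add of_nat_dvd_iff of_nat_mult of_nat_power)
  have "[(\<Prod>i\<in>?U. ?c + ?d i) = prod ?d ?U] (mod (int p ^ (r + 2 * s)))"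
  proof (rule prod_add_cong[where m = "int p ^ s" and e = ?e])
    show "int p ^ (r + 2 * s) dvd ?c * int p ^ s"
      using mult_dvd_mono[OF c' dvd_refl[of "int p ^ s"]] by (simp add: power_add mult_2 mult.assoc)
    have "int p ^ ((r + s) * 2) dvd ?c ^ 2" unfolding power_mult using c' by (rule dvd_power_same)
    thus "int p ^ (r + 2 * s) dvd ?c ^ 2"
      by (rule dvd_trans[rotated]) (intro le_imp_power_dvd, simp)
    show "int p ^ s dvd sum ?e ?U" using inv_sq_sum_units[OF p assms(6)] by (simp add: sum_negf)
    show "[?d i * ?e i = 1] (mod (int p ^ s))" if "i \<in> ?U" for i
    proof -
      have "\<not> int p dvd int i" using that by (auto simp: units_upto_def)
      hence "[int i ^ (inv_sq_exp p s + 2) = 1] (mod (int p ^ s))" by (rule inv_sq_exp_unit[OF p(1)])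
      moreover have "[int b = 0] (mod (int p ^ s))"
        using assms(6) by (metis cong_0_iff of_nat_dvd_iff of_nat_power)
      hence "[int i * (int b - int i) * ?e i = int i * (0 - int i) * ?e i] (mod (int p ^ s))"
        by (intro cong_scalar_right cong_scalar_left cong_diff cong_refl)
      moreover have "int i * (0 - int i) * ?e i = int i ^ (inv_sq_exp p s + 2)"
        by (simp add: power2_eq_square power_add)
      ultimately show ?thesis by (metis cong_trans)
    qed
  qed auto
  thus "[(\<Prod>i\<in>?U. int a + int i) ^ 2 = pfact p b ^ 2] (mod (int p ^ (r + 2 * s)))"
    using sq[of a] sq[of 0] by (simp add: pfact_def)
  show "[(\<Prod>i\<in>?U. int a + int i) = pfact p b] (mod int p)"
    unfolding pfact_def by (rule cong_prod) (use pa in \<open>auto simp: cong_iff_dvd_diff\<close>)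
  show "coprime (pfact p b) (int p)" by (rule pfact_coprime[OF p(1)])
qed

text \<open>\<open>prod_units_shift_cong\<close> needs \<open>p ^ (r + s)\<close> to divide
  \<open>a * (a + b)\<close>. This holds if \<open>p ^ r\<close> divides \<open>a\<close> or
  \<open>a + b\<close>; if it divides \<open>b\<close>, the roles of \<open>a\<close> and
  \<open>b\<close> are exchanged.\<close>

lemma pfact_add_cong:
  assumes p: "prime p" "p \<ge> 5" and s: "1 \<le> s" "s \<le> r" and a: "p ^ s dvd a" and b: "p ^ s dvd b"
    and ab: "p ^ r dvd a \<or> p ^ r dvd b \<or> p ^ r dvd a + b"
  shows "[pfact p a * pfact p b = pfact p (a + b)] (mod (int p ^ (r + 2 * s)))"
proof -
  have pa: "p dvd a" "p dvd b" using assms by (meson dvd_power dvd_trans less_le_trans zero_less_one)+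
  have "p ^ s dvd a + b" using a b by simp
  hence "p ^ (r + s) dvd a * (a + b) \<or> p ^ (r + s) dvd b * (b + a)"
    using ab a b mult_dvd_mono by (metis add.commute mult.commute power_add)
  thus ?thesis
  proof
    assume "p ^ (r + s) dvd a * (a + b)"
    from prod_units_shift_cong[OF p s a b this] show ?thesis
      by (simp add: pfact_add[OF pa(1)] cong_scalar_left cong_sym)
  next
    assume "p ^ (r + s) dvd b * (b + a)"
    from cong_scalar_left[OF prod_units_shift_cong[OF p s b a this], of "pfact p b"]
    have "[pfact p (b + a) = pfact p b * pfact p a] (mod (int p ^ (r + 2 * s)))"
      by (simp only: pfact_add[OF pa(2)])
    thus ?thesis by (simp only: add.commute mult.commute cong_sym_eq)
  qed
qed

text \<open>For \<open>s = r\<close> this is the exponent \<open>3 * r\<close> of Jacobsthal's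
  congruence. Smaller \<open>s\<close> serves indices with fewer factors \<open>p\<close>, as long
  as one of the three numbers keeps \<open>p ^ r\<close>.\<close>

lemma binomial_mult_unit_ratio:
  assumes p: "prime p" "p \<ge> 5" and s: "1 \<le> s" "s \<le> r" and "p ^ s dvd p * x" "p ^ s dvd p * y"
    and "p ^ r dvd p * x \<or> p ^ r dvd p * y \<or> p ^ r dvd p * (x + y)"
  shows "unit_ratio (int p) (r + 2 * s) (int ((p * (x + y)) choose (p * x))) (int ((x + y) choose x))"
proof -
  have "[pfact p (p * x) * pfact p (p * y) = pfact p (p * (x + y))] (mod (int p ^ (r + 2 * s)))"
    using pfact_add_cong[OF assms(1-6)] assms(7) by (simp add: distrib_left)
  moreover have "coprime (pfact p (p * x) * pfact p (p * y)) (int p)"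
    using pfact_coprime[OF p(1)] by simp
  moreover have "p > 0" using p by simp
  ultimately show ?thesis using binomial_mult_pfact unfolding unit_ratio_def by blast
qed

section \<open>Integer binomial coefficients\<close>

lemma ibinom_int: "rat_of_int (ibinom n (int k)) = rat_of_int n gchoose k"
  unfolding ibinom_def by (simp add: of_int_gbinomial[symmetric])

lemma ibinom_0_right [simp]: "ibinom n 0 = 1"
  unfolding ibinom_def by simp

lemma ibinom_of_nat: "ibinom (int n) (int k) = int (n choose k)"
proof -
  have "rat_of_int (ibinom (int n) (int k)) = rat_of_int (int (n choose k))"
    by (simp add: ibinom_int binomial_gbinomial)
  thus ?thesis by (simp only: of_int_eq_iff)
qed

text \<open>If \<open>k\<close> and \<open>n - k\<close> are both nonnegative, so is
  \<open>n\<close>, and ordinary symmetry applies. In the other cases the symmetry is built into the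
  definition.\<close>

lemma ibinom_symmetric: "ibinom n (n - k) = ibinom n k"
proof (cases "k \<ge> 0 \<and> n - k \<ge> 0")
  case True
  define x y where "x = nat k" and "y = nat (n - k)"
  have k: "k = int x" and n: "n = int (x + y)" and "n - k = int y"
    using True by (auto simp: x_def y_def)
  hence "ibinom n (n - k) = int ((x + y) choose y)" by (simp only: ibinom_of_nat)
  also have "\<dots> = int ((x + y) choose x)" using binomial_symmetric[of x "x + y"] by simp
  also have "\<dots> = ibinom n k" unfolding k n by (simp only: ibinom_of_nat)
  finally show ?thesis .
next
  case False
  thus ?thesis by (auto simp: ibinom_def)
qed

lemma ibinom_eq_0:
  assumes "k < 0 \<and> n < k \<or> n \<ge> 0 \<and> (k < 0 \<or> k > n)"
  shows "ibinom n k = 0"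
proof -
  have *: "ibinom m l = 0" if "m \<ge> 0" "l > m" for m l
  proof -
    have "ibinom (int (nat m)) (int (nat l)) = 0" using that by (subst ibinom_of_nat) auto
    thus ?thesis using that by simp
  qed
  show ?thesis
  proof (cases "n \<ge> 0")
    case True
    thus ?thesis using * [of n k] * [of n "n - k"] assms ibinom_symmetric[of n k] by auto
  next
    case False
    thus ?thesis using assms by (auto simp: ibinom_def)
  qed
qed

text \<open>The sign \<open>(-1) ^ k\<close>, for exponents that may be negative.\<close>

definition alt_sign :: "int \<Rightarrow> int" where
  "alt_sign k = (if even k then 1 else - 1)"

lemma ibinom_reflect:
  assumes "k \<ge> 0"
  shows "ibinom n k = alt_sign k * ibinom (k - n - 1) k"
proof -
  obtain j where j: "k = int j" using assms nonneg_int_cases by blast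
  have "alt_sign k = (-1) ^ j" by (simp add: j alt_sign_def)
  hence "rat_of_int (ibinom n k) = rat_of_int (alt_sign k * ibinom (k - n - 1) k)"
    using gbinomial_negated_upper[of "rat_of_int n" j] by (simp add: j ibinom_int)
  thus ?thesis by (simp only: of_int_eq_iff)
qed

lemma ibinom_absorb_Suc: "int (Suc k) * ibinom n (int (Suc k)) = n * ibinom (n - 1) (int k)"
proof -
  have "rat_of_int (int (Suc k) * ibinom n (int (Suc k))) = rat_of_int (n * ibinom (n - 1) (int k))"
    using gbinomial_absorption[of k "rat_of_int n"]
    by (simp add: ibinom_int del: of_nat_Suc)
  thus ?thesis by (simp only: of_int_eq_iff)
qed

lemma ibinom_absorb_comp: "(n - int k) * ibinom n (int k) = n * ibinom (n - 1) (int k)"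
proof -
  have "rat_of_int ((n - int k) * ibinom n (int k)) = rat_of_int (n * ibinom (n - 1) (int k))"
    using gbinomial_absorb_comp[of "rat_of_int n" k] by (simp add: ibinom_int)
  thus ?thesis by (simp only: of_int_eq_iff)
qed

text \<open>For negative \<open>k\<close>, symmetry moves to the lower index
  \<open>j = n - k\<close>, where the claim becomes \<open>ibinom_absorb_comp\<close>.\<close>

lemma ibinom_absorption:
  assumes "k \<noteq> 0"
  shows "k * ibinom n k = n * ibinom (n - 1) (k - 1)"
proof -
  consider "k > 0" | "k < 0" "n - k \<ge> 0" | "k < 0" "n - k < 0" using assms by linarith
  thus ?thesis
  proof cases
    case 1
    define j where "j = nat (k - 1)"
    have "k = int (Suc j)" "k - 1 = int j" using 1 by (auto simp: j_def)
    thus ?thesis using ibinom_absorb_Suc[of j n] by (simp only:)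
  next
    case 2
    then obtain j where j: "n - k = int j" using nonneg_int_cases by blast
    have "ibinom n k = ibinom n (int j)" using ibinom_symmetric[of n k] by (simp add: j)
    moreover have "ibinom (n - 1) (k - 1) = ibinom (n - 1) (int j)"
      using ibinom_symmetric[of "n - 1" "k - 1"] by (simp add: j)
    moreover have "k = n - int j" using j by simp
    ultimately show ?thesis using ibinom_absorb_comp[of n j] by simp
  next
    case 3
    thus ?thesis by (simp add: ibinom_eq_0)
  qed
qed

lemma ibinom_Suc:
  assumes "k \<ge> 0"
  shows "(k + 1) * ibinom n (k + 1) = (n - k) * ibinom n k"
proof -
  obtain j where j: "k = int j" using assms nonneg_int_cases by blast
  have "k + 1 = int (Suc j)" by (simp add: j)
  thus ?thesis using ibinom_absorb_Suc[of j n] ibinom_absorb_comp[of n j] by (simp only: j)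
qed

text \<open>Negating the upper index gives \<open>k + m - 1\<close>, which does not scale with
  \<open>p\<close>. The factor \<open>k + m\<close> restores the upper index \<open>k + m\<close>,
  which does.\<close>

lemma ibinom_uminus_mult:
  "int (k + m) * ibinom (- int m) (int k) = (-1) ^ k * (int m * int ((k + m) choose k))"
proof (cases "m = 0")
  case True
  thus ?thesis by (cases "k = 0") (auto simp: ibinom_eq_0)
next
  case False
  have "ibinom (- int m) (int k) = alt_sign (int k) * ibinom (int (k + m - 1)) (int k)"
    using False ibinom_reflect[of "int k" "- int m"] by (simp add: of_nat_diff)
  also have "\<dots> = (-1) ^ k * int ((k + m - 1) choose k)"
    by (simp add: ibinom_of_nat alt_sign_def del: of_nat_diff)
  finally have "int (k + m) * ibinom (- int m) (int k) =
      (-1) ^ k * int ((k + m) * ((k + m - 1) choose k))" by simp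
  also have "(k + m) * ((k + m - 1) choose k) = m * ((k + m) choose k)"
    using binomial_absorb_comp[of "k + m" k] by simp
  finally show ?thesis by simp
qed

lemma int_pow_dvd_mult_iff: "int p ^ s dvd int p * int x \<longleftrightarrow> p ^ s dvd p * x"
  by (metis of_nat_dvd_iff of_nat_mult of_nat_power)

lemma ibinom_mult_unit_ratio_nonneg:
  assumes p: "prime p" "p \<ge> 5" and s: "1 \<le> s" "s \<le> r"
    and n: "int p ^ s dvd int p * n" and k: "int p ^ s dvd int p * k"
    and nk: "int p ^ r dvd int p * n \<or> int p ^ r dvd int p * k \<or> int p ^ r dvd int p * (n - k)"
    and "k \<ge> 0" "n < 0 \<or> k \<le> n"
  shows "unit_ratio (int p) (r + 2 * s) (ibinom (int p * n) (int p * k)) (ibinom n k)"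
proof -
  obtain x where x: "k = int x" using \<open>k \<ge> 0\<close> nonneg_int_cases by blast
  show ?thesis
  proof (cases "n < 0")
    case False
    define y where "y = nat (n - k)"
    have y: "n = int (x + y)" and ny: "n - k = int y" using False assms x by (auto simp: y_def)
    have "int p ^ s dvd int p * (n - k)" using n k by (simp add: right_diff_distrib)
    hence "unit_ratio (int p) (r + 2 * s) (int ((p * (x + y)) choose (p * x))) (int ((x + y) choose x))"
      using k nk unfolding ny unfolding y x
      by (intro binomial_mult_unit_ratio p s) (auto simp only: int_pow_dvd_mult_iff)
    thus ?thesis unfolding y x by (simp only: of_nat_mult[symmetric] ibinom_of_nat)
  next
    case True
    define m where "m = nat (- n)"
    have m: "n = - int m" "m > 0" "k - n = int (x + m)" using True x by (auto simp: m_def)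
    have odd: "odd p" by (rule prime_ge_5_odd[OF p])
    \<comment> \<open>Up to sign, \<open>n\<close>, \<open>k\<close> and \<open>n - k\<close> become
      \<open>m\<close>, \<open>x\<close> and \<open>x + m\<close>, so the three alternatives of
      \<open>nk\<close> are merely permuted.\<close>
    have "int p * (n - k) = - (int p * int (x + m))" using m(3) by (simp add: algebra_simps)
    hence nk': "int p ^ r dvd int p * (n - k) \<longleftrightarrow> p ^ r dvd p * (x + m)"
      by (simp only: dvd_minus_iff int_pow_dvd_mult_iff)
    have n': "int p ^ e dvd int p * n \<longleftrightarrow> p ^ e dvd p * m" for e
      unfolding m(1) by (simp only: mult_minus_right dvd_minus_iff int_pow_dvd_mult_iff)
    have k': "int p ^ e dvd int p * k \<longleftrightarrow> p ^ e dvd p * x" for e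
      unfolding x by (simp only: int_pow_dvd_mult_iff)
    have "unit_ratio (int p) (r + 2 * s) (int ((p * (x + m)) choose (p * x))) (int ((x + m) choose x))"
      using n k nk unfolding n' k' nk' by (intro binomial_mult_unit_ratio p s) blast+
    hence "unit_ratio (int p) (r + 2 * s)
        ((-1) ^ (p * x) * (int m * int ((p * (x + m)) choose (p * x))))
        ((-1) ^ x * (int m * int ((x + m) choose x)))"
      using odd by (intro unit_ratio_minus_one_power unit_ratio_mult unit_ratio_refl) auto
    moreover have "int (x + m) * ibinom (int p * n) (int p * k) =
        (-1) ^ (p * x) * (int m * int ((p * (x + m)) choose (p * x)))"
    proof -
      have "int p * (int (x + m) * ibinom (int p * n) (int p * k)) =
          int p * ((-1) ^ (p * x) * (int m * int ((p * (x + m)) choose (p * x))))"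
        using ibinom_uminus_mult[of "p * x" "p * m"] by (simp add: m(1) x algebra_simps)
      thus ?thesis using p by (subst (asm) mult_left_cancel) auto
    qed
    moreover have "int (x + m) * ibinom n k = (-1) ^ x * (int m * int ((x + m) choose x))"
      using ibinom_uminus_mult[of x m] by (simp only: m(1) x)
    ultimately have "unit_ratio (int p) (r + 2 * s)
        (int (x + m) * ibinom (int p * n) (int p * k)) (int (x + m) * ibinom n k)"
      by (simp only:)
    thus ?thesis by (rule unit_ratio_cancel) (use m(2) in auto)
  qed
qed

text \<open>For \<open>k \<le> n < 0\<close> symmetry leads back to the lower index
  \<open>n - k \<ge> 0\<close>. Outside the support both binomials vanish, since scaling by
  \<open>p\<close> preserves the inequalities.\<close>

lemma ibinom_mult_unit_ratio:
  assumes p: "prime p" "p \<ge> 5" and s: "1 \<le> s" "s \<le> r"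
    and n: "int p ^ s dvd int p * n" and k: "int p ^ s dvd int p * k"
    and nk: "int p ^ r dvd int p * n \<or> int p ^ r dvd int p * k \<or> int p ^ r dvd int p * (n - k)"
  shows "unit_ratio (int p) (r + 2 * s) (ibinom (int p * n) (int p * k)) (ibinom n k)"
proof -
  have pos: "int p > 0" using p by simp
  consider "k \<ge> 0" "n < 0 \<or> k \<le> n" | "n < 0" "k \<le> n"
    | "k < 0 \<and> n < k \<or> n \<ge> 0 \<and> (k < 0 \<or> k > n)" by linarith
  thus ?thesis
  proof cases
    case 1
    thus ?thesis using assms by (intro ibinom_mult_unit_ratio_nonneg) auto
  next
    case 2
    have "int p ^ s dvd int p * (n - k)" using n k by (simp add: right_diff_distrib)
    hence "unit_ratio (int p) (r + 2 * s) (ibinom (int p * n) (int p * (n - k))) (ibinom n (n - k))"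
      using 2 assms by (intro ibinom_mult_unit_ratio_nonneg) auto
    thus ?thesis
      by (simp only: right_diff_distrib ibinom_symmetric)
  next
    case 3
    hence "int p * k < 0 \<and> int p * n < int p * k \<or> int p * n \<ge> 0 \<and> (int p * k < 0 \<or> int p * k > int p * n)"
      using pos by (simp add: mult_less_0_iff zero_le_mult_iff)
    thus ?thesis using 3 by (simp add: ibinom_eq_0 unit_ratio_refl)
  qed
qed

section \<open>Binomials under floor division of one index by \<open>p\<close>\<close>

lemma mult_minus_one_minus_div:
  fixes i :: int
  assumes "p > 0"
  shows "(p * m - 1 - i) div p = m - 1 - i div p"
proof (rule int_div_pos_eq)
  \<comment> \<open>A remainder \<open>u\<close> becomes \<open>p - 1 - u\<close>: the reflection
    maps blocks of length \<open>p\<close> onto blocks.\<close>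
  show "p * m - 1 - i = p * (m - 1 - i div p) + (p - 1 - i mod p)"
    using mult_div_mod_eq[of p i] by (simp add: algebra_simps)
  show "0 \<le> p - 1 - i mod p" "p - 1 - i mod p < p"
    using pos_mod_sign[OF assms, of i] pos_mod_bound[OF assms, of i] by linarith+
qed

text \<open>Going from \<open>i\<close> to \<open>i + 1\<close> multiplies by
  \<open>(p * M - (i + 1)) / (i + 1)\<close>. If \<open>p\<close> does not divide
  \<open>i + 1\<close>, this is congruent to -1; if \<open>i + 1 = p * q\<close>, it equals
  \<open>(M - q) / q\<close>, the step of the smaller binomial. The sign counts the non-multiples of
  \<open>p\<close> up to \<open>i\<close>.\<close>

lemma ibinom_pred_unit_ratio_nat:
  assumes p: "prime p" and M: "int p ^ r dvd int p * M"
  shows "unit_ratio (int p) r (ibinom (int p * M - 1) (int i))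
           (alt_sign (int i - int i div int p) * ibinom (M - 1) (int i div int p))"
proof (induction i)
  case 0
  show ?case by (simp add: alt_sign_def unit_ratio_refl)
next
  case (Suc i)
  let ?B = "ibinom (int p * M - 1) (int i)" and ?B' = "ibinom (int p * M - 1) (int (Suc i))"
  let ?b = "ibinom (M - 1) (int i div int p)"
  have pos: "p > 0" using p prime_gt_0_nat by blast
  have step: "int (Suc i) * ?B' = (int p * M - int (Suc i)) * ?B"
    using ibinom_Suc[of "int i" "int p * M - 1"] by (simp add: algebra_simps)
  show ?case
  proof (cases "p dvd Suc i")
    case False
    hence d: "Suc i div p = i div p" by (simp add: div_Suc dvd_eq_mod_eq_0)
    have "unit_ratio (int p) r (- ?B) (- (alt_sign (int i - int i div int p) * ?b))"
      by (rule unit_ratio_uminus[OF Suc.IH])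
    moreover have "int (Suc i) * ?B' = (int (Suc i) - int p * M) * (- ?B)"
      using step by (simp add: algebra_simps)
    moreover have "coprime (int (Suc i)) (int p)"
      using False by (simp only: coprime_int_prime_iff[OF p] of_nat_dvd_iff not_False_eq_True)
    moreover have "[int (Suc i) = int (Suc i) - int p * M] (mod int p ^ r)"
      using M by (simp add: cong_iff_dvd_diff)
    ultimately have "unit_ratio (int p) r ?B' (- (alt_sign (int i - int i div int p) * ?b))"
      by (rule unit_ratio_step)
    moreover have "int (Suc i) div int p = int i div int p" using d by (metis zdiv_int)
    moreover have "alt_sign (int (Suc i) - int i div int p) = - alt_sign (int i - int i div int p)"
      by (simp add: alt_sign_def)
    ultimately show ?thesis by simp
  next
    case True
    then obtain q where q: "Suc i = p * q" by blast
    have "Suc i div p = Suc (i div p)" using True by (simp add: div_Suc dvd_eq_mod_eq_0)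
    moreover have "Suc i div p = q" using q pos by simp
    ultimately have d: "q = Suc (i div p)" by simp
    have d1: "int i div int p = int q - 1" using d by (simp add: zdiv_int)
    have d2: "int (Suc i) div int p = int q" using q pos by simp
    let ?s = "alt_sign (int i - int i div int p)"
    have s: "alt_sign (int (Suc i) - int (Suc i) div int p) = ?s" unfolding d1 d2 by (simp add: alt_sign_def)
    have "int p * (int q * ?B') = int p * ((M - int q) * ?B)"
      using step unfolding q by (simp add: algebra_simps)
    hence B: "int q * ?B' = (M - int q) * ?B" using pos by (subst (asm) mult_left_cancel) auto
    have b: "int q * ibinom (M - 1) (int q) = (M - int q) * ?b"
      using ibinom_Suc[of "int q - 1" "M - 1"] d unfolding d1 by (simp add: algebra_simps)
    have "unit_ratio (int p) r ((M - int q) * ?B) ((M - int q) * (?s * ?b))"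
      by (intro unit_ratio_mult unit_ratio_refl Suc.IH)
    moreover have "(M - int q) * (?s * ?b) = int q * (?s * ibinom (M - 1) (int q))"
      using b by (metis mult.left_commute)
    ultimately have "unit_ratio (int p) r (int q * ?B') (int q * (?s * ibinom (M - 1) (int q)))"
      by (simp only: B)
    hence "unit_ratio (int p) r ?B' (?s * ibinom (M - 1) (int q))"
      by (rule unit_ratio_cancel) (use d in auto)
    thus ?thesis unfolding s unfolding d2 .
  qed
qed

lemma ibinom_pred_unit_ratio:
  assumes p: "prime p" "odd p" and M: "int p ^ r dvd int p * M"
  shows "unit_ratio (int p) r (ibinom (int p * M - 1) i)
           (alt_sign (i - i div int p) * ibinom (M - 1) (i div int p))"
proof -
  have pos: "int p > 0" using p prime_gt_0_nat by auto
  let ?j = "int p * M - 1 - i"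
  have dj: "?j div int p = M - 1 - i div int p" by (rule mult_minus_one_minus_div[OF pos])
  consider "i \<ge> 0" | "i < 0" "?j \<ge> 0" | "i < 0" "?j < 0" by linarith
  thus ?thesis
  proof cases
    case 1
    thus ?thesis using ibinom_pred_unit_ratio_nat[OF p(1) M, of "nat i"] by simp
  next
    case 2
    have "unit_ratio (int p) r (ibinom (int p * M - 1) ?j)
           (alt_sign (?j - ?j div int p) * ibinom (M - 1) (?j div int p))"
      using ibinom_pred_unit_ratio_nat[OF p(1) M, of "nat ?j"] 2 by simp
    \<comment> \<open>The two exponents add up to \<open>(p - 1) * M\<close>, which is even.\<close>
    moreover have "alt_sign (?j - ?j div int p) = alt_sign (i - i div int p)"
      unfolding dj using p(2) by (auto simp: alt_sign_def)
    ultimately show ?thesis by (simp only: dj ibinom_symmetric)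
  next
    case 3
    hence "?j div int p < 0" "i div int p < 0"
      using pos_imp_zdiv_neg_iff[OF pos] by blast+
    hence "ibinom (M - 1) (i div int p) = 0" using dj by (intro ibinom_eq_0) auto
    moreover have "ibinom (int p * M - 1) i = 0" using 3 by (intro ibinom_eq_0) auto
    ultimately show ?thesis by (simp add: unit_ratio_refl)
  qed
qed

text \<open>Going from \<open>x\<close> to \<open>x + 1\<close> multiplies by
  \<open>(x + 1) / (x + 1 - p * M)\<close>. This is congruent to 1 if \<open>p\<close> does not
  divide \<open>x + 1\<close>; otherwise \<open>p\<close> cancels and it is the step of the smaller
  binomial.\<close>

lemma binomial_div_unit_ratio:
  assumes p: "prime p" and M: "p ^ r dvd p * M"
  shows "unit_ratio (int p) r (int (x choose (p * M))) (int ((x div p) choose M))"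
proof (cases "p * M \<le> x")
  case False
  hence "x div p < M" using p prime_gt_0_nat by (simp add: div_less_iff_less_mult mult.commute)
  hence "int (x choose (p * M)) = 0" "int ((x div p) choose M) = 0" using False by auto
  thus ?thesis by (simp only: unit_ratio_refl)
next
  case True
  have pos: "p > 0" using p prime_gt_0_nat by blast
  show ?thesis using True
  proof (induction x rule: nat_induct_at_least)
    case base
    show ?case using pos by (simp add: unit_ratio_refl)
  next
    case (Suc x)
    let ?B = "x choose (p * M)" and ?B' = "Suc x choose (p * M)"
    have st: "(Suc x - p * M) * ?B' = Suc x * ?B"
      using binomial_absorb_comp[of "Suc x" "p * M"] by simp
    show ?case
    proof (cases "p dvd Suc x")
      case False
      hence d: "Suc x div p = x div p" by (simp add: div_Suc dvd_eq_mod_eq_0)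
      have i: "int (Suc x - p * M) = int (Suc x) - int p * int M"
        using Suc.hyps by (simp add: of_nat_diff del: of_nat_Suc)
      have "int (Suc x - p * M) * int ?B' = int (Suc x) * int ?B"
        using st by (metis of_nat_mult)
      moreover have "\<not> p dvd Suc x - p * M"
        using False Suc.hyps by (metis dvd_diffD dvd_triv_left le_SucI)
      hence "coprime (int (Suc x - p * M)) (int p)"
        by (simp only: coprime_int_prime_iff[OF p] of_nat_dvd_iff not_False_eq_True)
      moreover have "[int (Suc x - p * M) = int (Suc x)] (mod int p ^ r)"
        using M unfolding i by (simp add: cong_iff_dvd_diff int_pow_dvd_mult_iff)
      ultimately show ?thesis unfolding d by (rule unit_ratio_step[OF Suc.IH])
    next
      case True
      then obtain q where q: "Suc x = p * q" by blast
      have "Suc x div p = Suc (x div p)" using True by (simp add: div_Suc dvd_eq_mod_eq_0)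
      moreover have d2: "Suc x div p = q" using q pos by simp
      ultimately have d: "q = Suc (x div p)" by simp
      let ?b = "(x div p) choose M"
      have "p * M < p * q" unfolding q[symmetric] using Suc.hyps by (rule le_imp_less_Suc)
      hence lt: "M < q" by simp
      have "p * q - p * M = p * (q - M)" by (simp only: diff_mult_distrib2)
      hence "p * ((q - M) * ?B') = p * (q * ?B)" using st by (simp only: q mult.assoc)
      hence B: "(q - M) * ?B' = q * ?B" using pos by (subst (asm) mult_left_cancel) auto
      have b: "(q - M) * (q choose M) = q * ?b"
        using binomial_absorb_comp[of q M] d by simp
      have "unit_ratio (int p) r (int q * int ?B) (int q * int ?b)"
        by (intro unit_ratio_mult unit_ratio_refl Suc.IH)
      hence "unit_ratio (int p) r (int (q - M) * int ?B') (int (q - M) * int (q choose M))"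
        by (metis B b of_nat_mult)
      hence "unit_ratio (int p) r (int ?B') (int (q choose M))"
        by (rule unit_ratio_cancel) (use lt in auto)
      thus ?thesis unfolding d2 .
    qed
  qed
qed

lemma unit_ratio_alt_sign:
  "unit_ratio p e x y \<Longrightarrow> unit_ratio p e (alt_sign k * x) (alt_sign k * y)"
  by (rule unit_ratio_mult[OF unit_ratio_refl])

text \<open>Negating the upper index reduces negative \<open>x\<close> with \<open>M \<ge> 0\<close>
  to natural numbers. For negative \<open>M\<close> within the support, symmetry and negation lead
  to the upper index \<open>p * (- M) - 1\<close> of \<open>ibinom_pred_unit_ratio\<close>.\<close>

lemma ibinom_div_unit_ratio:
  assumes p: "prime p" "odd p" and M: "int p ^ r dvd int p * M"
  shows "unit_ratio (int p) r (ibinom x (int p * M)) (ibinom (x div int p) M)"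
proof -
  have pos: "int p > 0" using p prime_gt_0_nat by auto
  have nonneg: "unit_ratio (int p) r (ibinom y (int p * M)) (ibinom (y div int p) M)"
    if "M \<ge> 0" "y \<ge> 0" for y
  proof -
    define M' y' where "M' = nat M" and "y' = nat y"
    hence *: "M = int M'" "y = int y'" using that by auto
    show ?thesis using binomial_div_unit_ratio[OF p(1), of r M' y'] M
      unfolding * int_pow_dvd_mult_iff
      by (simp only: of_nat_mult[symmetric] zdiv_int[symmetric] ibinom_of_nat)
  qed
  consider "M \<ge> 0" "x \<ge> 0" | "M \<ge> 0" "x < 0" | "M < 0" "x < 0" "int p * M \<le> x"
    | "M < 0" "x \<ge> 0 \<or> x < int p * M" by linarith
  thus ?thesis
  proof cases
    case 1
    thus ?thesis by (rule nonneg)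
  next
    case 2
    let ?y = "int p * M - x - 1"
    have dy: "?y div int p = M - x div int p - 1"
      using mult_minus_one_minus_div[OF pos, of M x] by (simp add: algebra_simps)
    have "0 \<le> int p * M" using 2 pos by simp
    hence "unit_ratio (int p) r (alt_sign M * ibinom ?y (int p * M)) (alt_sign M * ibinom (?y div int p) M)"
      using 2 by (intro unit_ratio_alt_sign nonneg) linarith+
    moreover have "alt_sign M = alt_sign (int p * M)" using p(2) by (simp add: alt_sign_def)
    hence "ibinom x (int p * M) = alt_sign M * ibinom ?y (int p * M)"
      using ibinom_reflect[OF \<open>0 \<le> int p * M\<close>, of x] by (simp only:)
    moreover have "ibinom (x div int p) M = alt_sign M * ibinom (?y div int p) M"
      unfolding dy by (rule ibinom_reflect[OF 2(1)])
    ultimately show ?thesis by (simp only:)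
  next
    case 3
    let ?l = "x - int p * M"
    have l: "?l \<ge> 0" using 3 by simp
    have dl: "?l div int p = x div int p - M"
      using pos div_mult_self1[of "int p" x "- M"] by (simp add: mult.commute)
    have dl0: "x div int p - M \<ge> 0" using l pos dl by (metis pos_imp_zdiv_nonneg_iff)
    have "int p ^ r dvd int p * (- M)" using M by simp
    from unit_ratio_alt_sign[OF ibinom_pred_unit_ratio[OF p this, of ?l], of ?l]
    have "unit_ratio (int p) r (alt_sign ?l * ibinom (int p * (- M) - 1) ?l)
        (alt_sign ?l * (alt_sign (?l - ?l div int p) * ibinom (- M - 1) (?l div int p)))" .
    moreover have "alt_sign ?l * ibinom (int p * (- M) - 1) ?l = ibinom x (int p * M)"
      using ibinom_reflect[OF l, of x] ibinom_symmetric[of x "int p * M"] by simp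
    moreover have "alt_sign ?l * (alt_sign (?l - ?l div int p) * ibinom (- M - 1) (?l div int p))
      = ibinom (x div int p) M"
    proof -
      have "alt_sign ?l * alt_sign (?l - ?l div int p) = alt_sign (?l div int p)"
        by (auto simp: alt_sign_def)
      moreover have "alt_sign (?l div int p) * ibinom (- M - 1) (?l div int p) = ibinom (x div int p) M"
        using ibinom_reflect[OF dl0, of "x div int p"] ibinom_symmetric[of "x div int p" M]
        unfolding dl by simp
      ultimately show ?thesis by (simp only: mult.assoc[symmetric])
    qed
    ultimately show ?thesis by (simp only:)
  next
    case 4
    have "x div int p < M" if "x < int p * M"
    proof (rule ccontr)
      assume "\<not> x div int p < M"
      hence "int p * M \<le> int p * (x div int p)" using pos by simp
      also have "\<dots> \<le> x" using mult_div_mod_eq[of "int p" x] pos_mod_sign[OF pos, of x] by linarith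
      finally show False using that by simp
    qed
    hence "x div int p \<ge> 0 \<or> x div int p < M"
      using 4(2) pos_imp_zdiv_nonneg_iff[OF pos, of x] by blast
    moreover have "int p * M < 0" using 4 pos by (simp add: mult_less_0_iff)
    ultimately have "ibinom x (int p * M) = 0" "ibinom (x div int p) M = 0"
      using 4 by (auto intro!: ibinom_eq_0)
    thus ?thesis by (simp add: unit_ratio_refl)
  qed
qed

section \<open>Descent along base-\<open>p\<close> blocks\<close>

lemma sum_blocks:
  fixes p a b :: int
  assumes "p > 0"
  shows "(\<Sum>i\<in>{p * a..<p * b}. f i) = (\<Sum>j\<in>{a..<b}. \<Sum>u\<in>{0..<p}. f (p * j + u))"
proof -
  have lt: "p * j + u < p * b" if "j < b" "u < p" for j u
  proof -
    have "p * (j + 1) \<le> p * b" using that assms by (intro mult_left_mono) auto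
    thus ?thesis using that by (simp add: distrib_left)
  qed
  have ge: "p * a \<le> p * j + u" if "a \<le> j" "0 \<le> u" for j u
  proof -
    have "p * a \<le> p * j" using that assms by (intro mult_left_mono) auto
    thus ?thesis using that by simp
  qed
  have "(\<Sum>i\<in>{p * a..<p * b}. f i) = (\<Sum>(j, u)\<in>{a..<b} \<times> {0..<p}. f (p * j + u))"
  proof (rule sum.reindex_bij_witness[where i = "\<lambda>(j, u). p * j + u" and j = "\<lambda>i. (i div p, i mod p)"])
    fix i assume i: "i \<in> {p * a..<p * b}"
    have "a \<le> i div p" using zdiv_mono1[of "p * a" i p] i assms by simp
    moreover have "i div p < b"
    proof (rule ccontr)
      assume "\<not> i div p < b"
      hence "p * b \<le> p * (i div p)" using assms by simp
      also have "\<dots> \<le> i" using mult_div_mod_eq[of p i] pos_mod_sign[OF assms, of i] by linarith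
      finally show False using i by simp
    qed
    ultimately show "(i div p, i mod p) \<in> {a..<b} \<times> {0..<p}" using assms by simp
  next
    fix x assume "x \<in> {a..<b} \<times> {0..<p}"
    thus "(case x of (j, u) \<Rightarrow> p * j + u) \<in> {p * a..<p * b}" using lt ge by auto
  qed (use assms in auto)
  thus ?thesis by (simp add: sum.cartesian_product)
qed

text \<open>Each step replaces \<open>C (Suc s) i\<close> by \<open>C s (i div p)\<close> and absorbs the inner sums over a block
  into the weight, whose divisibility by \<open>p\<close> makes up for the weaker modulus at the next level.\<close>

lemma descent_sum_dvd:
  fixes p a b :: int
  assumes p: "p > 0"
    and C: "\<And>s i. [C (Suc s) i = C s (i div p)] (mod p ^ Suc s)"
    and w: "\<And>s j. s \<le> r \<Longrightarrow> p ^ (s + t) dvd (\<Sum>u\<in>{0..<p ^ s}. w (p ^ s * j + u))"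
  shows "p ^ (r + t) dvd (\<Sum>i\<in>{p ^ r * a..<p ^ r * b}. C r i * w i)"
  using w
proof (induction r arbitrary: t w)
  case 0
  have "{0..<1::int} = {0}" by auto
  hence "p ^ t dvd w i" for i using "0.prems"[of 0 i] by simp
  thus ?case by (auto intro!: dvd_sum)
next
  case (Suc r)
  define w' where "w' = (\<lambda>j. \<Sum>u\<in>{0..<p}. w (p * j + u))"
  have "{0..<1::int} = {0}" by auto
  hence dvd_w: "p ^ t dvd w i" for i using Suc.prems[of 0 i] by simp
  \<comment> \<open>A block of length \<open>p ^ s\<close> for \<open>w'\<close> is one of length
    \<open>p ^ Suc s\<close> for \<open>w\<close>. Hence \<open>t\<close> grows by one while
    \<open>r\<close> drops by one, and the final modulus is unchanged.\<close>
  have IH: "p ^ (r + Suc t) dvd (\<Sum>j\<in>{p ^ r * a..<p ^ r * b}. C r j * w' j)"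
  proof (rule Suc.IH)
    fix s j assume "s \<le> r"
    have "(\<Sum>i\<in>{p * 0..<p * p ^ s}. w (p * p ^ s * j + i)) =
        (\<Sum>v\<in>{0..<p ^ s}. \<Sum>u\<in>{0..<p}. w (p * p ^ s * j + (p * v + u)))"
      by (rule sum_blocks[OF p])
    hence "(\<Sum>i\<in>{0..<p ^ Suc s}. w (p ^ Suc s * j + i)) = (\<Sum>v\<in>{0..<p ^ s}. w' (p ^ s * j + v))"
      by (simp add: w'_def algebra_simps)
    thus "p ^ (s + Suc t) dvd (\<Sum>v\<in>{0..<p ^ s}. w' (p ^ s * j + v))"
      using Suc.prems[of "Suc s" j] \<open>s \<le> r\<close> by simp
  qed
  have "[C (Suc r) i * w i = C r (i div p) * w i] (mod p ^ (Suc r + t))" for i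
  proof -
    have "p ^ Suc r dvd C (Suc r) i - C r (i div p)" using C[of r i] by (simp only: cong_iff_dvd_diff)
    hence "p ^ Suc r * p ^ t dvd (C (Suc r) i - C r (i div p)) * w i" using dvd_w by (rule mult_dvd_mono)
    thus ?thesis by (simp only: cong_iff_dvd_diff left_diff_distrib power_add)
  qed
  hence "[(\<Sum>i\<in>{p ^ Suc r * a..<p ^ Suc r * b}. C (Suc r) i * w i) =
      (\<Sum>i\<in>{p ^ Suc r * a..<p ^ Suc r * b}. C r (i div p) * w i)] (mod p ^ (Suc r + t))"
    by (intro cong_sum)
  moreover have "(\<Sum>i\<in>{p ^ Suc r * a..<p ^ Suc r * b}. C r (i div p) * w i) =
      (\<Sum>j\<in>{p ^ r * a..<p ^ r * b}. C r j * w' j)"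
    using sum_blocks[OF p, of "\<lambda>i. C r (i div p) * w i" "p ^ r * a" "p ^ r * b"] p
    by (simp add: w'_def sum_distrib_left mult.assoc)
  ultimately show ?case using IH cong_dvd_iff by (metis add_Suc_shift)
qed

section \<open>The supercongruence\<close>

text \<open>Two of the factors suffice: \<open>n1 \<ge> 0\<close> forces
  \<open>0 \<le> k \<le> n1\<close>, and \<open>n1 < 0\<close> forces
  \<open>n1 + n2 < k \<le> n2\<close>.\<close>

lemma A_term_support:
  assumes "A_term n1 n2 n3 n4 k \<noteq> 0"
  shows "\<bar>k\<bar> \<le> \<bar>n1\<bar> + \<bar>n2\<bar>"
proof -
  have "ibinom n1 k \<noteq> 0" "ibinom (n1 + n2 - k) n1 \<noteq> 0" using assms by (auto simp: A_term_def)
  hence "\<not> (n1 \<ge> 0 \<and> (k < 0 \<or> k > n1))" "\<not> (n1 < 0 \<and> n1 + n2 - k < n1)"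
    "\<not> (n1 + n2 - k \<ge> 0 \<and> n1 < 0)" using ibinom_eq_0 by blast+
  thus ?thesis by linarith
qed

text \<open>The range is asymmetric so that the later shift to \<open>k - 1\<close> turns it into
  \<open>{- X..<X}\<close>, a union of full blocks when \<open>X\<close> is a multiple of the block
  length.\<close>

lemma A_eq_sum:
  assumes "\<bar>n1\<bar> + \<bar>n2\<bar> < X"
  shows "A n1 n2 n3 n4 = (\<Sum>k\<in>{1 - X..X}. A_term n1 n2 n3 n4 k)"
  unfolding A_def
proof (rule sum.mono_neutral_left)
  show "{k. A_term n1 n2 n3 n4 k \<noteq> 0} \<subseteq> {1 - X..X}"
    using A_term_support assms by fastforce
qed auto

text \<open>By absorption \<open>p ^ q\<close> divides \<open>k * ibinom n k\<close>, and
  \<open>k\<close> accounts for only \<open>p ^ s\<close> of it.\<close>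

lemma dvd_ibinom:
  assumes p: "prime p" and "int p ^ q dvd n" "k = int p ^ s * k0" "\<not> int p dvd k0" "s \<le> q"
  shows "int p ^ (q - s) dvd ibinom n k"
proof -
  have pos: "int p ^ s \<noteq> 0" using p by auto
  have "k \<noteq> 0" using assms by auto
  hence "int p ^ q dvd k * ibinom n k" using assms(2) by (simp add: ibinom_absorption)
  moreover have "int p ^ q = int p ^ s * int p ^ (q - s)" using assms(5) by (simp add: power_add[symmetric])
  moreover have "k * ibinom n k = int p ^ s * (k0 * ibinom n k)"
    using assms(3) by (metis mult.assoc)
  ultimately have "int p ^ (q - s) dvd k0 * ibinom n k"
    using pos dvd_mult_cancel_left by metis
  moreover have "coprime (int p ^ (q - s)) k0"
    using assms(4) coprime_int_prime_iff[OF p] by (simp add: coprime_commute)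
  ultimately show ?thesis by (simp add: coprime_dvd_mult_right_iff)
qed

lemma A_term_multiple_cong:
  fixes N1 N2 N3 N4 :: int
  assumes p: "prime p" "p \<ge> 5"
    and N: "int p ^ q dvd N1" "int p ^ q dvd N2" "int p ^ q dvd N3" "int p ^ q dvd N4"
  shows "[A_term (int p * N1) (int p * N2) (int p * N3) (int p * N4) (int p * k) =
          A_term N1 N2 N3 N4 k] (mod (int p ^ (3 * Suc q)))"
proof -
  have pr: "prime (int p)" using p by simp
  \<comment> \<open>The minimum of \<open>q\<close> and the exponent of \<open>p\<close> in
    \<open>k\<close>, with \<open>s = q\<close> for \<open>k = 0\<close>. As the actual index is
    \<open>p * k\<close>, its exponent is \<open>Suc s\<close>.\<close>
  obtain s where s: "s \<le> q" "int p ^ s dvd k"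
    "\<And>n. int p ^ q dvd n \<Longrightarrow> int p ^ (q - s) dvd ibinom n k"
  proof (cases "int p ^ q dvd k")
    case True
    thus ?thesis by (intro that[of q]) auto
  next
    case False
    hence "k \<noteq> 0" by auto
    then obtain k0 where k0: "k = int p ^ multiplicity (int p) k * k0" "\<not> int p dvd k0"
      using multiplicity_decompose'[of k "int p"] pr by (metis not_prime_unit)
    have "multiplicity (int p) k \<le> q"
      using False by (metis dvd_trans le_imp_power_dvd multiplicity_dvd nat_le_linear)
    with dvd_ibinom[OF p(1) _ k0] show ?thesis
      by (intro that[of "multiplicity (int p) k"]) (auto intro: multiplicity_dvd)
  qed
  let ?e = "Suc q + 2 * Suc s"
  have up: "int p ^ Suc s dvd int p * n" if "int p ^ s dvd n" for n using that by simp
  have Nq: "int p ^ Suc q dvd int p * n" if "int p ^ q dvd n" for n using that by simp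
  have Ns: "int p ^ s dvd n" if "int p ^ q dvd n" for n
    using that s(1) by (meson dvd_trans le_imp_power_dvd)
  have 1: "unit_ratio (int p) ?e (ibinom (int p * n) (int p * k)) (ibinom n k)"
    if "int p ^ q dvd n" for n
    by (rule ibinom_mult_unit_ratio[OF p]) (use s(1,2) that up Nq Ns in auto)
  have 2: "unit_ratio (int p) ?e (ibinom (int p * n + int p * m - int p * k) (int p * n)) (ibinom (n + m - k) n)"
    if "int p ^ q dvd n" "int p ^ q dvd m" for n m
  proof -
    have "int p ^ s dvd n + m - k" using Ns that s(2) by auto
    hence "unit_ratio (int p) ?e (ibinom (int p * (n + m - k)) (int p * n)) (ibinom (n + m - k) n)"
      by (intro ibinom_mult_unit_ratio[OF p]) (use s(1,2) that up Nq Ns in auto)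
    thus ?thesis by (simp only: distrib_left right_diff_distrib)
  qed
  have "unit_ratio (int p) ?e (A_term (int p * N1) (int p * N2) (int p * N3) (int p * N4) (int p * k))
          (A_term N1 N2 N3 N4 k)"
    unfolding A_term_def by (intro unit_ratio_mult 1 2 N)
  \<comment> \<open>The first two factors supply \<open>q - s\<close> each, just what
    \<open>?e\<close> lacks to reach \<open>3 * Suc q\<close>.\<close>
  moreover have "int p ^ (2 * (q - s)) dvd A_term N1 N2 N3 N4 k"
    unfolding A_term_def mult_2 power_add using s(3) N by (intro dvd_mult2 mult_dvd_mono) auto
  ultimately have "[A_term (int p * N1) (int p * N2) (int p * N3) (int p * N4) (int p * k) =
          A_term N1 N2 N3 N4 k] (mod (int p ^ (?e + 2 * (q - s))))"
    by (rule unit_ratio_imp_cong)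
  moreover have "?e + 2 * (q - s) = 3 * Suc q" using s(1) by simp
  ultimately show ?thesis by (simp only:)
qed

text \<open>What absorption leaves of \<open>A_term\<close> at \<open>k = i + 1\<close> beside
  \<open>n1 * n3\<close>. The shifted index is the one compatible with floor division by
  \<open>p\<close>.\<close>

definition C_term :: "int \<Rightarrow> int \<Rightarrow> int \<Rightarrow> int \<Rightarrow> int \<Rightarrow> int" where
  "C_term n1 n2 n3 n4 i =
     ibinom (n1 - 1) i * ibinom (n3 - 1) i * ibinom (n1 + n2 - 1 - i) n1 * ibinom (n3 + n4 - 1 - i) n3"

text \<open>The first two binomials produce the same sign, which squares to 1.\<close>

lemma C_term_cong:
  fixes N1 N2 N3 N4 :: int
  assumes p: "prime p" "odd p"
    and N: "int p ^ q dvd N1" "int p ^ q dvd N2" "int p ^ q dvd N3" "int p ^ q dvd N4"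
  shows "[C_term (int p * N1) (int p * N2) (int p * N3) (int p * N4) i =
          C_term N1 N2 N3 N4 (i div int p)] (mod (int p ^ Suc q))"
proof -
  have pos: "int p > 0" using p prime_gt_0_nat by auto
  have Nq: "int p ^ Suc q dvd int p * n" if "int p ^ q dvd n" for n using that by simp
  let ?s = "alt_sign (i - i div int p)"
  have 1: "unit_ratio (int p) (Suc q) (ibinom (int p * n - 1) i) (?s * ibinom (n - 1) (i div int p))"
    if "int p ^ q dvd n" for n
    by (rule ibinom_pred_unit_ratio[OF p Nq[OF that]])
  have 2: "unit_ratio (int p) (Suc q) (ibinom (int p * n + int p * m - 1 - i) (int p * n))
             (ibinom (n + m - 1 - i div int p) n)" if "int p ^ q dvd n" for n m
    using ibinom_div_unit_ratio[OF p Nq[OF that], of "int p * (n + m) - 1 - i"]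
    unfolding mult_minus_one_minus_div[OF pos] by (simp only: distrib_left)
  have "unit_ratio (int p) (Suc q) (C_term (int p * N1) (int p * N2) (int p * N3) (int p * N4) i)
     ((?s * ibinom (N1 - 1) (i div int p)) * (?s * ibinom (N3 - 1) (i div int p)) *
       ibinom (N1 + N2 - 1 - i div int p) N1 * ibinom (N3 + N4 - 1 - i div int p) N3)"
    unfolding C_term_def by (intro unit_ratio_mult 1 2 N)
  also have "(?s * ibinom (N1 - 1) (i div int p)) * (?s * ibinom (N3 - 1) (i div int p)) *
       ibinom (N1 + N2 - 1 - i div int p) N1 * ibinom (N3 + N4 - 1 - i div int p) N3 =
       C_term N1 N2 N3 N4 (i div int p)"
    by (simp add: C_term_def alt_sign_def)
  finally show ?thesis using unit_ratio_imp_cong[where f = 0] by fastforce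
qed

lemma A_term_absorption:
  assumes "k \<noteq> 0"
  shows "k ^ 2 * A_term n1 n2 n3 n4 k = n1 * n3 * C_term n1 n2 n3 n4 (k - 1)"
proof -
  have "k ^ 2 * A_term n1 n2 n3 n4 k = (k * ibinom n1 k) * (k * ibinom n3 k) *
      ibinom (n1 + n2 - k) n1 * ibinom (n3 + n4 - k) n3"
    by (simp add: A_term_def power2_eq_square)
  also have "\<dots> = (n1 * ibinom (n1 - 1) (k - 1)) * (n3 * ibinom (n3 - 1) (k - 1)) *
      ibinom (n1 + n2 - k) n1 * ibinom (n3 + n4 - k) n3"
    by (simp only: ibinom_absorption[OF assms])
  also have "\<dots> = n1 * n3 * C_term n1 n2 n3 n4 (k - 1)" by (simp add: C_term_def algebra_simps)
  finally show ?thesis .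
qed

text \<open>The descent with \<open>t = 0\<close> and weight
  \<open>(i + 1) ^ inv_sq_exp p r\<close>, whose block sums are those of
  \<open>inv_sq_sum_block\<close>.\<close>

lemma sum_C_term_dvd:
  fixes p r :: nat and n1 n2 n3 n4 L :: int
  assumes p: "prime p" "p \<ge> 5"
  defines "P \<equiv> int p ^ r"
  shows "P dvd (\<Sum>k\<in>{1 - P * L..P * L}. C_term (P * n1) (P * n2) (P * n3) (P * n4) (k - 1) * k ^ inv_sq_exp p r)"
proof -
  let ?C = "\<lambda>s. C_term (int p ^ s * n1) (int p ^ s * n2) (int p ^ s * n3) (int p ^ s * n4)"
  have "int p ^ (r + 0) dvd (\<Sum>i\<in>{int p ^ r * (- L)..<int p ^ r * L}. ?C r i * (i + 1) ^ inv_sq_exp p r)"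
  proof (rule descent_sum_dvd[where C = ?C])
    show "int p > 0" using p by simp
    show "[?C (Suc s) i = ?C s (i div int p)] (mod int p ^ Suc s)" for s i
      using C_term_cong[OF p(1) prime_ge_5_odd[OF p], of s "int p ^ s * n1" "int p ^ s * n2"
          "int p ^ s * n3" "int p ^ s * n4" i] by (simp add: mult.assoc)
    show "int p ^ (s + 0) dvd (\<Sum>u\<in>{0..<int p ^ s}. (int p ^ s * j + u + 1) ^ inv_sq_exp p r)"
      if "s \<le> r" for s j
    proof -
      let ?a = "int p ^ s * j + 1"
      have "(\<Sum>i\<in>{?a..<?a + int p ^ s}. i ^ inv_sq_exp p r) =
          (\<Sum>u\<in>{0..<int p ^ s}. (int p ^ s * j + u + 1) ^ inv_sq_exp p r)"
        by (rule sum.reindex_bij_witness[of _ "\<lambda>u. int p ^ s * j + u + 1" "\<lambda>i. i - ?a"]) auto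
      thus ?thesis using inv_sq_sum_block[OF p that, of ?a] by simp
    qed
  qed
  also have "(\<Sum>i\<in>{int p ^ r * (- L)..<int p ^ r * L}. ?C r i * (i + 1) ^ inv_sq_exp p r) =
      (\<Sum>k\<in>{1 - P * L..P * L}. C_term (P * n1) (P * n2) (P * n3) (P * n4) (k - 1) * k ^ inv_sq_exp p r)"
    by (rule sum.reindex_bij_witness[of _ "\<lambda>k. k - 1" "\<lambda>i. i + 1"]) (auto simp: P_def)
  finally show ?thesis by (simp add: P_def)
qed

lemma sum_A_term_nonmultiples_dvd:
  fixes p r :: nat and n1 n2 n3 n4 L :: int
  assumes p: "prime p" "p \<ge> 5"
  defines "P \<equiv> int p ^ r"
  shows "int p ^ (3 * r) dvd
    (\<Sum>k\<in>{k \<in> {1 - P * L..P * L}. \<not> int p dvd k}. A_term (P * n1) (P * n2) (P * n3) (P * n4) k)"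
proof -
  let ?K = "{1 - P * L..P * L}" and ?e = "inv_sq_exp p r"
  let ?T = "A_term (P * n1) (P * n2) (P * n3) (P * n4)" and ?C = "C_term (P * n1) (P * n2) (P * n3) (P * n4)"
  have P3: "int p ^ (3 * r) = P ^ 2 * P"
    by (simp add: P_def power_mult[symmetric] power_add[symmetric] algebra_simps)
  \<comment> \<open>Multiples of \<open>p\<close> cost nothing on the right, where
    \<open>k ^ ?e\<close> is divisible by \<open>P\<close>. This extends the sum to the whole
    interval, as the descent requires.\<close>
  have cong: "[(if int p dvd k then 0 else ?T k) = P ^ 2 * n1 * n3 * (?C (k - 1) * k ^ ?e)] (mod P ^ 2 * P)" for k
  proof (cases "int p dvd k")
    case True
    hence "P dvd k ^ ?e" unfolding P_def by (rule inv_sq_exp_multiple[OF p])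
    hence "P ^ 2 * P dvd P ^ 2 * k ^ ?e" by (rule mult_dvd_mono[OF dvd_refl])
    hence "P ^ 2 * P dvd (P ^ 2 * k ^ ?e) * (n1 * n3 * ?C (k - 1))" by (rule dvd_mult2)
    thus ?thesis using True by (simp add: cong_0_iff cong_sym_eq[of 0] mult_ac)
  next
    case False
    hence "k \<noteq> 0" by auto
    hence T: "k ^ 2 * ?T k = P ^ 2 * (n1 * n3 * ?C (k - 1))"
      unfolding A_term_absorption[OF \<open>k \<noteq> 0\<close>] by (simp only: power2_eq_square mult_ac)
    have "coprime (P ^ 2) (k ^ 2)" using False coprime_int_prime_iff[OF p(1), of k]
      by (simp add: P_def coprime_commute)
    \<comment> \<open>With \<open>P ^ 2\<close> already dividing the term, inverting
      \<open>k ^ 2\<close> modulo \<open>P\<close> alone is enough modulo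
      \<open>P ^ 2 * P\<close>.\<close>
    hence "P ^ 2 dvd ?T k" using T by (metis coprime_dvd_mult_right_iff dvd_triv_left)
    moreover have "P dvd k ^ (?e + 2) - 1"
      using inv_sq_exp_unit[OF p(1) False, of r] by (simp add: P_def cong_iff_dvd_diff)
    ultimately have "P ^ 2 * P dvd ?T k * (k ^ (?e + 2) - 1)" by (rule mult_dvd_mono)
    also have "?T k * (k ^ (?e + 2) - 1) = (k ^ 2 * ?T k) * k ^ ?e - ?T k"
      by (simp add: power_add power2_eq_square algebra_simps)
    finally have "P ^ 2 * P dvd P ^ 2 * n1 * n3 * (?C (k - 1) * k ^ ?e) - ?T k"
      unfolding T by (simp only: mult.assoc)
    thus ?thesis using False by (simp add: cong_iff_dvd_diff dvd_diff_commute)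
  qed
  have *: "(\<Sum>k\<in>{k \<in> ?K. \<not> int p dvd k}. ?T k) = (\<Sum>k\<in>?K. if int p dvd k then 0 else ?T k)"
    by (rule sum.mono_neutral_cong_left) auto
  have "[(\<Sum>k\<in>?K. if int p dvd k then 0 else ?T k) =
      (\<Sum>k\<in>?K. P ^ 2 * n1 * n3 * (?C (k - 1) * k ^ ?e))] (mod P ^ 2 * P)"
    by (intro cong_sum cong)
  hence "[(\<Sum>k\<in>{k \<in> ?K. \<not> int p dvd k}. ?T k) =
      (\<Sum>k\<in>?K. P ^ 2 * n1 * n3 * (?C (k - 1) * k ^ ?e))] (mod P ^ 2 * P)"
    unfolding * .
  moreover have "P ^ 2 * P dvd (\<Sum>k\<in>?K. P ^ 2 * n1 * n3 * (?C (k - 1) * k ^ ?e))"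
  proof -
    have "P dvd (\<Sum>k\<in>?K. ?C (k - 1) * k ^ ?e)" unfolding P_def by (rule sum_C_term_dvd[OF p])
    hence "P ^ 2 * P dvd P ^ 2 * n1 * n3 * (\<Sum>k\<in>?K. ?C (k - 1) * k ^ ?e)"
      by (intro mult_dvd_mono dvd_mult2 dvd_refl)
    thus ?thesis by (simp only: sum_distrib_left)
  qed
  ultimately show ?thesis unfolding P3 using cong_dvd_iff by blast
qed

theorem theorem1p2:
  fixes p :: nat and r :: nat and n1 n2 n3 n4 :: int
  assumes "prime p" and "p \<ge> 5" and "r \<ge> 1"
  shows "[A (int p ^ r * n1) (int p ^ r * n2) (int p ^ r * n3) (int p ^ r * n4)
          = A (int p ^ (r - 1) * n1) (int p ^ (r - 1) * n2) (int p ^ (r - 1) * n3) (int p ^ (r - 1) * n4)]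
         (mod (int p ^ (3 * r)))"
proof -
  obtain q where r: "r = Suc q" using assms(3) by (cases r) auto
  define Q where "Q = int p ^ q"
  have pos: "int p > 0" and Qpos: "Q > 0" using assms by (simp_all add: Q_def)
  have P: "int p ^ r = int p * Q" by (simp add: r Q_def)
  \<comment> \<open>The summand 1 makes the bound strict even for \<open>n1 = n2 = 0\<close>. One
    \<open>L\<close> serves both levels, so that the ranges correspond under \<open>k\<close> to
    \<open>p * k\<close>.\<close>
  define L where "L = \<bar>n1\<bar> + \<bar>n2\<bar> + 1"
  let ?T = "A_term (int p ^ r * n1) (int p ^ r * n2) (int p ^ r * n3) (int p ^ r * n4)"
  let ?T' = "A_term (Q * n1) (Q * n2) (Q * n3) (Q * n4)"
  let ?K = "{1 - int p ^ r * L..int p ^ r * L}"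
  have bound: "\<bar>X * n1\<bar> + \<bar>X * n2\<bar> < X * L" if "X > 0" for X
    using that by (simp add: abs_mult L_def distrib_left)
  have A_r: "A (int p ^ r * n1) (int p ^ r * n2) (int p ^ r * n3) (int p ^ r * n4) = (\<Sum>k\<in>?K. ?T k)"
    using pos by (intro A_eq_sum bound) simp
  have split: "(\<Sum>k\<in>?K. ?T k) = (\<Sum>k\<in>{k \<in> ?K. int p dvd k}. ?T k) + (\<Sum>k\<in>{k \<in> ?K. \<not> int p dvd k}. ?T k)"
    by (subst sum.union_disjoint[symmetric])
      (auto intro!: sum.cong intro: finite_subset[of _ ?K])
  have main: "[(\<Sum>k\<in>{k \<in> ?K. int p dvd k}. ?T k) + (\<Sum>k\<in>{k \<in> ?K. \<not> int p dvd k}. ?T k) =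
      (\<Sum>k\<in>{1 - Q * L..Q * L}. ?T' k) + 0] (mod (int p ^ (3 * r)))"
  proof (rule cong_add)
    show "[(\<Sum>k\<in>{k \<in> ?K. \<not> int p dvd k}. ?T k) = 0] (mod (int p ^ (3 * r)))"
      unfolding cong_0_iff by (rule sum_A_term_nonmultiples_dvd[OF assms(1,2)])
    have range: "int p * k \<in> ?K \<longleftrightarrow> k \<in> {1 - Q * L..Q * L}" for k
    proof -
      \<comment> \<open>Only as a strict inequality does the lower bound scale by
        \<open>p\<close>.\<close>
      have "1 - int p * (Q * L) \<le> int p * k \<longleftrightarrow> int p * (- (Q * L)) < int p * k" by auto
      also have "\<dots> \<longleftrightarrow> 1 - Q * L \<le> k" using pos by (subst mult_less_cancel_left_pos) auto
      finally show ?thesis using pos by (simp add: P mult.assoc)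
    qed
    have "{k \<in> ?K. int p dvd k} = (\<lambda>k. int p * k) ` {1 - Q * L..Q * L}"
      unfolding dvd_def using range by blast
    hence eq: "(\<Sum>k\<in>{k \<in> ?K. int p dvd k}. ?T k) = (\<Sum>k\<in>{1 - Q * L..Q * L}. ?T (int p * k))"
      using pos by (simp add: sum.reindex inj_on_def)
    show "[(\<Sum>k\<in>{k \<in> ?K. int p dvd k}. ?T k) = (\<Sum>k\<in>{1 - Q * L..Q * L}. ?T' k)]
        (mod (int p ^ (3 * r)))"
      unfolding eq unfolding P mult.assoc unfolding r
      by (intro cong_sum A_term_multiple_cong assms(1,2)) (simp_all add: Q_def)
  qed
  have A_q: "A (Q * n1) (Q * n2) (Q * n3) (Q * n4) = (\<Sum>k\<in>{1 - Q * L..Q * L}. ?T' k) + 0"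
    unfolding add_0_right by (rule A_eq_sum[OF bound[OF Qpos]])
  have "r - 1 = q" by (simp add: r)
  thus ?thesis using main unfolding A_r split by (simp only: A_q[symmetric] Q_def[symmetric])
qed

end
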